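(* Let $\Bbbk$ be an algebraically closed field of characteristic zero, let $n\ge1$ and $m_1,\dots,m_n\ge1$ be integers, and let $G=\mathbb{Z}_{m_1}\times\cdots\times\mathbb{Z}_{m_n}$, where $g_i$ is a fixed generator of the factor $\mathbb{Z}_{m_i}$ (multiplicative notation). Let $\underline{\mathbf a}=\big((a_l)_{1\le l\le n},(a_{st})_{1\le s<t\le n},(a_{rst})_{1\le r<s<t\le n}\big)$ be a family of integers with $0\le a_l<m_l$, $0\le a_{st}<(m_s,m_t)$, $0\le a_{rst}<(m_r,m_s,m_t)$, let $\omega=\omega_{\underline{\mathbf a}}$ be the associated normalized $3$-cocycle on $G$ (defined in the context), and let $r_{ij}\in\Bbbk^*$ for $1\le i,j\le n$. Then there is a quasi-bicharacter $\mathcal{R}$ of $G$ with respect to $\omega_{\underline{\mathbf a}}$ satisfying $\mathcal{R}(g_i,g_j)=r_{ij}$ for all $1\le i,j\le n$ if and only if the following equations hold: $$r_{ii}^{m_i}=\zeta_{m_i}^{a_i}=\zeta_{m_i}^{-a_i}\quad\text{for } 1\le i\le n,$$ $$r_{ij}^{m_i}=\zeta_{m_j}^{-a_{ij}},\qquad r_{ij}^{m_j}=1\quad\text{for } 1\le i<j\le n,$$ $$r_{ij}^{m_j}=\zeta_{m_i}^{a_{ji}},\qquad r_{ij}^{m_i}=1\quad\text{for } n\ge i>j\ge 1,$$ $$a_{rst}=0\quad\text{for } 1\le r<s<t\le n.$$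
   Context: $\Bbbk^*=\Bbbk\setminus\{0\}$. $(s_1,\dots,s_t)$ denotes the greatest common divisor; $[\frac{s}{t}]$ denotes the integer part of $\frac{s}{t}$; for each positive integer $m$, $\zeta_m\in\Bbbk$ is a fixed primitive $m$-th root of unity. The normalized $3$-cocycle $\omega_{\underline{\mathbf a}}:G^3\to\Bbbk^*$ is $$\omega_{\underline{\mathbf a}}\big(g_1^{i_1}\cdots g_n^{i_n},\,g_1^{j_1}\cdots g_n^{j_n},\,g_1^{k_1}\cdots g_n^{k_n}\big)=\prod_{l=1}^{n}\zeta_{m_l}^{a_l i_l\left[\frac{j_l+k_l}{m_l}\right]}\prod_{1\le s<t\le n}\zeta_{m_t}^{a_{st}i_t\left[\frac{j_s+k_s}{m_s}\right]}\prod_{1\le r<s<t\le n}\zeta_{(m_r,m_s,m_t)}^{-a_{rst}k_rj_si_t}$$ for $0\le i_l,j_l,k_l<m_l$, $1\le l\le n$. A quasi-bicharacter of $G$ with respect to $\omega$ is a function $\mathcal{R}:G\times G\to\Bbbk^*$ such that for all $x,y,z\in G$ $$\mathcal{R}(xy,z)=\omega(z,x,y)\,\mathcal{R}(x,z)\,\omega^{-1}(x,z,y)\,\mathcal{R}(y,z)\,\omega(x,y,z),$$ $$\mathcal{R}(x,yz)=\omega^{-1}(y,z,x)\,\mathcal{R}(x,z)\,\omega(y,x,z)\,\mathcal{R}(x,y)\,\omega^{-1}(x,y,z).$$ (These are the hexagon axioms; quasi-bicharacters with respect to $\omega$ are exactly the braidings of the category $\mathrm{Vec}_G^\omega$ of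 finite-dimensional $G$-graded vector spaces with associativity constraint $\omega$, where $\mathcal{R}(x,y)$ is the scalar of the braiding on the one-dimensional objects of degrees $x$ and $y$.) *)

theory Defs
  imports
    "HOL-Algebra.Product_Groups"
    "HOL-Algebra.Elementary_Groups"
    "HOL-Algebra.Multiplicative_Group"
    "HOL-Computational_Algebra.Polynomial"
begin

definition primitive_root_of_unity :: "nat \<Rightarrow> 'k::field \<Rightarrow> bool" where
  "primitive_root_of_unity m z \<longleftrightarrow> z ^ m = 1 \<and> (\<forall>k. 0 < k \<and> k < m \<longrightarrow> z ^ k \<noteq> 1)"

definition cyc_prod :: "nat \<Rightarrow> (nat \<Rightarrow> nat) \<Rightarrow> (nat \<Rightarrow> int) monoid" where
  "cyc_prod n m = product_group {1..n} (\<lambda>l. integer_mod_group (m l))"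

text \<open>The image in the product of the generator \<open>\<gamma> l\<close> of the \<open>l\<close>-th factor.\<close>

definition cyc_gen :: "nat \<Rightarrow> (nat \<Rightarrow> nat) \<Rightarrow> (nat \<Rightarrow> int) \<Rightarrow> nat \<Rightarrow> (nat \<Rightarrow> int)" where
  "cyc_gen n m \<gamma> l =
     (\<lambda>p\<in>{1..n}. if p = l then \<gamma> l else \<one>\<^bsub>integer_mod_group (m p)\<^esub>)"

text \<open>The exponents \<open>0 \<le> i\<^sub>l < m\<^sub>l\<close> in the normal form
  \<open>x = g\<^sub>1\<^bsup>i\<^sub>1\<^esup> \<cdots> g\<^sub>n\<^bsup>i\<^sub>n\<^esup>\<close>; lemma \<open>cyc_exp_unique\<close> shows that they are well defined.\<close>

definition cyc_exp ::
    "nat \<Rightarrow> (nat \<Rightarrow> nat) \<Rightarrow> (nat \<Rightarrow> int) \<Rightarrow> (nat \<Rightarrow> int) \<Rightarrow> nat \<Rightarrow> nat" where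
  "cyc_exp n m \<gamma> x =
     (THE i. i \<in> (\<Pi>\<^sub>E l\<in>{1..n}. {0..<m l}) \<and>
        x = (\<Otimes>\<^bsub>cyc_prod n m\<^esub>l\<in>{1..n}. cyc_gen n m \<gamma> l [^]\<^bsub>cyc_prod n m\<^esub> i l))"

definition cocycle ::
    "(nat \<Rightarrow> 'k::field) \<Rightarrow> nat \<Rightarrow> (nat \<Rightarrow> nat) \<Rightarrow> (nat \<Rightarrow> int) \<Rightarrow>
     (nat \<Rightarrow> int) \<Rightarrow> (nat \<Rightarrow> nat \<Rightarrow> int) \<Rightarrow> (nat \<Rightarrow> nat \<Rightarrow> nat \<Rightarrow> int) \<Rightarrow>
     (nat \<Rightarrow> int) \<Rightarrow> (nat \<Rightarrow> int) \<Rightarrow> (nat \<Rightarrow> int) \<Rightarrow> 'k" where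
  "cocycle \<zeta> n m \<gamma> a1 a2 a3 x y z =
     (let i = cyc_exp n m \<gamma> x; j = cyc_exp n m \<gamma> y; k = cyc_exp n m \<gamma> z in
        (\<Prod>l\<in>{1..n}. \<zeta> (m l) powi (a1 l * int (i l) * int ((j l + k l) div m l))) *
        (\<Prod>t\<in>{1..n}. \<Prod>s\<in>{1..<t}.
           \<zeta> (m t) powi (a2 s t * int (i t) * int ((j s + k s) div m s))) *
        (\<Prod>t\<in>{1..n}. \<Prod>s\<in>{1..<t}. \<Prod>r\<in>{1..<s}.
           \<zeta> (gcd (m r) (gcd (m s) (m t))) powi (- a3 r s t * int (k r) * int (j s) * int (i t))))"

definition quasi_bicharacter ::
    "('g, 'b) monoid_scheme \<Rightarrow> ('g \<Rightarrow> 'g \<Rightarrow> 'g \<Rightarrow> 'k::field) \<Rightarrow> ('g \<Rightarrow> 'g \<Rightarrow> 'k) \<Rightarrow> bool" where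
  "quasi_bicharacter G \<omega> R \<longleftrightarrow>
     (\<forall>x\<in>carrier G. \<forall>y\<in>carrier G. R x y \<noteq> 0) \<and>
     (\<forall>x\<in>carrier G. \<forall>y\<in>carrier G. \<forall>z\<in>carrier G.
        R (x \<otimes>\<^bsub>G\<^esub> y) z =
          \<omega> z x y * R x z * inverse (\<omega> x z y) * R y z * \<omega> x y z \<and>
        R x (y \<otimes>\<^bsub>G\<^esub> z) =
          inverse (\<omega> y z x) * R x z * \<omega> y x z * R x y * inverse (\<omega> x y z))"

lemma comm_group_cyc_prod: "comm_group (cyc_prod n m)"
proof -
  interpret group "cyc_prod n m"
    by (simp add: cyc_prod_def)
  show ?thesis
    by (rule group_comm_groupI) (auto simp: cyc_prod_def restrict_def fun_eq_iff add.commute)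
qed

lemma cyc_gen_closed:
  assumes "\<And>l. l \<in> {1..n} \<Longrightarrow> \<gamma> l \<in> carrier (integer_mod_group (m l))"
  shows "l \<in> {1..n} \<Longrightarrow> cyc_gen n m \<gamma> l \<in> carrier (cyc_prod n m)"
  using assms by (auto simp: cyc_gen_def cyc_prod_def)

lemma pow_cyc_prod_nth:
  "p \<in> {1..n} \<Longrightarrow>
   (x [^]\<^bsub>cyc_prod n m\<^esub> (e::nat)) p = x p [^]\<^bsub>integer_mod_group (m p)\<^esub> e"
  by (induction e) (auto simp: cyc_prod_def nat_pow_def simp del: pow_integer_mod_group)

lemma finprod_cyc_prod_nth:
  assumes gen: "\<And>l. l \<in> {1..n} \<Longrightarrow> \<gamma> l \<in> carrier (integer_mod_group (m l))"
    and "finite A" "A \<subseteq> {1..n}" "p \<in> {1..n}"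
  shows "(\<Otimes>\<^bsub>cyc_prod n m\<^esub>l\<in>A. cyc_gen n m \<gamma> l [^]\<^bsub>cyc_prod n m\<^esub> (i l :: nat)) p =
    (if p \<in> A then \<gamma> p [^]\<^bsub>integer_mod_group (m p)\<^esub> i p else \<one>\<^bsub>integer_mod_group (m p)\<^esub>)"
  using assms(2,3)
proof (induction A rule: finite_induct)
  case empty
  interpret comm_group "cyc_prod n m" by (rule comm_group_cyc_prod)
  show ?case using assms(4) by (simp add: cyc_prod_def[symmetric]) (simp add: cyc_prod_def)
next
  case (insert q A)
  interpret comm_group "cyc_prod n m" by (rule comm_group_cyc_prod)
  let ?f = "\<lambda>l. cyc_gen n m \<gamma> l [^]\<^bsub>cyc_prod n m\<^esub> i l"
  have cl: "?f l \<in> carrier (cyc_prod n m)" if "l \<in> {1..n}" for l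
    using cyc_gen_closed[where \<gamma> = \<gamma>, OF gen that] by simp
  have "finprod (cyc_prod n m) ?f (insert q A) = ?f q \<otimes>\<^bsub>cyc_prod n m\<^esub> finprod (cyc_prod n m) ?f A"
    using insert cl by (intro finprod_insert) auto
  moreover have "(x \<otimes>\<^bsub>cyc_prod n m\<^esub> y) p = x p \<otimes>\<^bsub>integer_mod_group (m p)\<^esub> y p" for x y
    using assms(4) by (simp add: cyc_prod_def)
  ultimately have "finprod (cyc_prod n m) ?f (insert q A) p =
      ?f q p \<otimes>\<^bsub>integer_mod_group (m p)\<^esub> finprod (cyc_prod n m) ?f A p"
    by metis
  also have "?f q p = (if p = q then \<gamma> p [^]\<^bsub>integer_mod_group (m p)\<^esub> i p
      else \<one>\<^bsub>integer_mod_group (m p)\<^esub>)"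
    using assms(4) by (auto simp: pow_cyc_prod_nth cyc_gen_def)
  finally show ?case
    using insert by auto
qed

lemma cyc_exp_unique:
  assumes pos: "\<And>l. l \<in> {1..n} \<Longrightarrow> 0 < m l"
    and gen: "\<And>l. l \<in> {1..n} \<Longrightarrow> \<gamma> l \<in> carrier (integer_mod_group (m l))"
      "\<And>l. l \<in> {1..n} \<Longrightarrow>
         generate (integer_mod_group (m l)) {\<gamma> l} = carrier (integer_mod_group (m l))"
    and x: "x \<in> carrier (cyc_prod n m)"
  shows "\<exists>!i. i \<in> (\<Pi>\<^sub>E l\<in>{1..n}. {0..<m l}) \<and>
    x = (\<Otimes>\<^bsub>cyc_prod n m\<^esub>l\<in>{1..n}. cyc_gen n m \<gamma> l [^]\<^bsub>cyc_prod n m\<^esub> i l)"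
proof -
  interpret comm_group "cyc_prod n m" by (rule comm_group_cyc_prod)
  have bij: "bij_betw (\<lambda>e::nat. \<gamma> l [^]\<^bsub>integer_mod_group (m l)\<^esub> e)
      {0..<m l} (carrier (integer_mod_group (m l)))" if l: "l \<in> {1..n}" for l
  proof -
    interpret L: group "integer_mod_group (m l)" by simp
    have card: "card (carrier (integer_mod_group (m l))) = m l"
      using pos[OF l] by (simp add: carrier_integer_mod_group)
    have fin: "finite (carrier (integer_mod_group (m l)))"
      using pos[OF l] by (simp add: carrier_integer_mod_group)
    have o: "L.ord (\<gamma> l) = m l"
      using L.generate_pow_card[OF gen(1)[OF l]] gen(2)[OF l] card by simp
    have inj: "inj_on (\<lambda>e::nat. \<gamma> l [^]\<^bsub>integer_mod_group (m l)\<^esub> e) {0..<m l}"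
      using L.ord_inj[OF gen(1)[OF l]] unfolding o
      by (rule inj_on_subset) (use pos[OF l] in auto)
    have "(\<lambda>e::nat. \<gamma> l [^]\<^bsub>integer_mod_group (m l)\<^esub> e) ` {0..<m l} \<subseteq> carrier (integer_mod_group (m l))"
      using gen(1)[OF l] by (auto simp del: pow_integer_mod_group)
    then show ?thesis
      using inj fin card by (simp add: bij_betw_def card_subset_eq card_image del: pow_integer_mod_group)
  qed
  have eq_iff: "x = (\<Otimes>\<^bsub>cyc_prod n m\<^esub>l\<in>{1..n}. cyc_gen n m \<gamma> l [^]\<^bsub>cyc_prod n m\<^esub> i l) \<longleftrightarrow>
      (\<forall>l\<in>{1..n}. x l = \<gamma> l [^]\<^bsub>integer_mod_group (m l)\<^esub> i l)" for i :: "nat \<Rightarrow> nat"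
  proof -
    let ?P = "\<Otimes>\<^bsub>cyc_prod n m\<^esub>l\<in>{1..n}. cyc_gen n m \<gamma> l [^]\<^bsub>cyc_prod n m\<^esub> i l"
    have "?P \<in> carrier (cyc_prod n m)"
      using cyc_gen_closed[where \<gamma> = \<gamma>, OF gen(1)] by (intro finprod_closed) auto
    then have ext: "x \<in> extensional {1..n}" "?P \<in> extensional {1..n}"
      using x by (auto simp: cyc_prod_def PiE_def)
    have nth: "?P l = \<gamma> l [^]\<^bsub>integer_mod_group (m l)\<^esub> i l" if "l \<in> {1..n}" for l
      using finprod_cyc_prod_nth[where \<gamma> = \<gamma> and A = "{1..n}" and p = l and m = m and i = i and n = n] gen(1) that
      by (simp del: pow_integer_mod_group)
    show ?thesis
    proof
      assume "x = ?P" then show "\<forall>l\<in>{1..n}. x l = \<gamma> l [^]\<^bsub>integer_mod_group (m l)\<^esub> i l"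
        using nth by metis
    next
      assume "\<forall>l\<in>{1..n}. x l = \<gamma> l [^]\<^bsub>integer_mod_group (m l)\<^esub> i l"
      then show "x = ?P" using nth by (intro extensionalityI[OF ext]) metis
    qed
  qed
  have ex: "\<exists>!e. e \<in> {0..<m l} \<and> x l = \<gamma> l [^]\<^bsub>integer_mod_group (m l)\<^esub> e" if l: "l \<in> {1..n}" for l
  proof -
    have "x l \<in> carrier (integer_mod_group (m l))"
      using x l by (auto simp: cyc_prod_def)
    then obtain e where e: "e \<in> {0..<m l}" "x l = \<gamma> l [^]\<^bsub>integer_mod_group (m l)\<^esub> e"
      using bij_betw_imp_surj_on[OF bij[OF l]] by blast
    show ?thesis
    proof (rule ex1I[of _ e])
      fix e' assume "e' \<in> {0..<m l} \<and> x l = \<gamma> l [^]\<^bsub>integer_mod_group (m l)\<^esub> e'"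
      then show "e' = e"
        using e by (intro inj_onD[OF bij_betw_imp_inj_on[OF bij[OF l]]])
          (auto simp del: pow_integer_mod_group)
    qed (use e in blast)
  qed
  define i where "i = (\<lambda>l\<in>{1..n}. THE e. e \<in> {0..<m l} \<and> x l = \<gamma> l [^]\<^bsub>integer_mod_group (m l)\<^esub> e)"
  have i: "i l \<in> {0..<m l} \<and> x l = \<gamma> l [^]\<^bsub>integer_mod_group (m l)\<^esub> i l" if "l \<in> {1..n}" for l
    using theI'[OF ex[OF that]] that by (simp add: i_def del: pow_integer_mod_group)
  show ?thesis
    unfolding eq_iff
  proof (rule ex1I[of _ i])
    show "i \<in> (\<Pi>\<^sub>E l\<in>{1..n}. {0..<m l}) \<and> (\<forall>l\<in>{1..n}. x l = \<gamma> l [^]\<^bsub>integer_mod_group (m l)\<^esub> i l)"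
      using i by (auto simp: PiE_def i_def simp del: pow_integer_mod_group)
  next
    fix k assume k: "k \<in> (\<Pi>\<^sub>E l\<in>{1..n}. {0..<m l}) \<and> (\<forall>l\<in>{1..n}. x l = \<gamma> l [^]\<^bsub>integer_mod_group (m l)\<^esub> k l)"
    show "k = i"
    proof (rule extensionalityI[of _ "{1..n}"])
      show "k \<in> extensional {1..n}" using k by (simp add: PiE_def)
      show "i \<in> extensional {1..n}" by (simp add: i_def)
      show "k l = i l" if l: "l \<in> {1..n}" for l
      proof -
        have "k l \<in> {0..<m l} \<and> x l = \<gamma> l [^]\<^bsub>integer_mod_group (m l)\<^esub> k l"
          using k l by (blast dest: PiE_mem)
        then show ?thesis using ex[OF l] i[OF l] by blast
      qed
    qed
  qed
qed

end

theory Submission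
  imports Defs
begin

text \<open>
  Comparing both sides of the first hexagon for \<open>xy\<close> and \<open>yx\<close> on three generators isolates
  \<open>\<zeta>\<^bsup>-a\<^esup>\<close> with \<open>a = a\<^sub>r\<^sub>s\<^sub>t\<close>, so the last factor of the cocycle must vanish. What remains is symmetric in
  its last two arguments, and the hexagons collapse to
  \<open>R(xy,z) = R(x,z) R(y,z) \<omega>(z,x,y)\<close> and \<open>R(x,yz) = R(x,y) R(x,z) / \<omega>(x,y,z)\<close>:
  a quasi-bicharacter is bimultiplicative in the exponents up to a factor for every carry.
  Evaluating at \<open>g\<^sub>i\<close> to the power \<open>m\<^sub>i\<close>, which is trivial and produces exactly one carry, gives the
  equations for the \<open>r\<^sub>i\<^sub>j\<close>; conversely these are what makes
  \<open>R(x,y) = \<Prod> r\<^sub>i\<^sub>j\<close> to the power \<open>x\<^sub>i y\<^sub>j\<close> satisfy the hexagons.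
\<close>

section \<open>Preliminaries on roots of unity and guarded products\<close>

lemma primitive_root_of_unity_nonzero:
  assumes "primitive_root_of_unity d z" "d \<ge> 1"
  shows "z \<noteq> 0"
  using assms by (auto simp: primitive_root_of_unity_def power_0_left)

lemma primitive_root_of_unity_powi_eq_1D:
  assumes "primitive_root_of_unity d z" "0 \<le> a" "a < int d" "z powi a = 1"
  shows "a = 0"
proof (rule ccontr)
  assume "a \<noteq> 0"
  with assms(2,3) have "0 < nat a" "nat a < d" by auto
  moreover from assms(2,4) have "z ^ nat a = 1" by (simp add: power_int_def)
  ultimately show False using assms(1) by (auto simp: primitive_root_of_unity_def)
qed

text \<open>Hoists a guard that does not mention the bound variable out of a product, so that a
  nested product of nested guards can be evaluated by \<open>prod.delta\<close> one index at a
  time.\<close>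

lemma prod_if_const:
  "(\<Prod>x\<in>A. if P then f x else 1) = (if P then \<Prod>x\<in>A. f x else (1 :: 'a :: comm_monoid_mult))"
  by simp

section \<open>Exponents of elements in a product of cyclic groups\<close>

locale cyclic_product =
  fixes n :: nat and m :: "nat \<Rightarrow> nat" and \<gamma> :: "nat \<Rightarrow> int"
  assumes pos: "l \<in> {1..n} \<Longrightarrow> m l \<ge> 1"
    and gen_closed: "l \<in> {1..n} \<Longrightarrow> \<gamma> l \<in> carrier (integer_mod_group (m l))"
    and gen: "l \<in> {1..n} \<Longrightarrow>
      generate (integer_mod_group (m l)) {\<gamma> l} = carrier (integer_mod_group (m l))"
begin

abbreviation "G \<equiv> cyc_prod n m"
abbreviation "g \<equiv> cyc_gen n m \<gamma>"
abbreviation "ex \<equiv> cyc_exp n m \<gamma>"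

sublocale comm_group G
  by (rule comm_group_cyc_prod)

lemma g_closed: "l \<in> {1..n} \<Longrightarrow> g l \<in> carrier G"
  by (rule cyc_gen_closed) (rule gen_closed)

lemma finprod_g_closed: "(\<Otimes>\<^bsub>G\<^esub>l\<in>{1..n}. g l [^]\<^bsub>G\<^esub> (i l :: nat)) \<in> carrier G"
  by (intro finprod_closed) (simp add: g_closed Pi_iff)

lemma finprod_g_nth:
  "p \<in> {1..n} \<Longrightarrow> (\<Otimes>\<^bsub>G\<^esub>l\<in>{1..n}. g l [^]\<^bsub>G\<^esub> (i l :: nat)) p =
     \<gamma> p [^]\<^bsub>integer_mod_group (m p)\<^esub> i p"
  using finprod_cyc_prod_nth[of n \<gamma> m "{1..n}" p i] gen_closed
  by (simp del: pow_integer_mod_group)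

lemma cyc_prod_eqI:
  assumes "x \<in> carrier G" "y \<in> carrier G" "\<And>l. l \<in> {1..n} \<Longrightarrow> x l = y l"
  shows "x = y"
  using assms by (intro extensionalityI[of x "{1..n}" y]) (auto simp: cyc_prod_def PiE_def)

lemma normal_form_unique:
  assumes "x \<in> carrier G"
  shows "\<exists>!i. i \<in> (\<Pi>\<^sub>E l\<in>{1..n}. {0..<m l}) \<and> x = (\<Otimes>\<^bsub>G\<^esub>l\<in>{1..n}. g l [^]\<^bsub>G\<^esub> i l)"
  using pos by (intro cyc_exp_unique gen_closed gen assms) (simp add: Suc_le_eq)

lemma ex_props:
  assumes "x \<in> carrier G"
  shows "ex x \<in> (\<Pi>\<^sub>E l\<in>{1..n}. {0..<m l})"
    and "x = (\<Otimes>\<^bsub>G\<^esub>l\<in>{1..n}. g l [^]\<^bsub>G\<^esub> ex x l)"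
proof -
  from theI'[OF normal_form_unique[OF assms]] show "ex x \<in> (\<Pi>\<^sub>E l\<in>{1..n}. {0..<m l})"
    "x = (\<Otimes>\<^bsub>G\<^esub>l\<in>{1..n}. g l [^]\<^bsub>G\<^esub> ex x l)"
    unfolding cyc_exp_def[symmetric] by blast+
qed

lemma nth_eq_pow_ex:
  assumes "x \<in> carrier G" "l \<in> {1..n}"
  shows "x l = \<gamma> l [^]\<^bsub>integer_mod_group (m l)\<^esub> ex x l"
  using finprod_g_nth[OF assms(2), of "ex x"] ex_props(2)[OF assms(1)] by metis

lemma pow_gen_mod:
  "\<gamma> l [^]\<^bsub>integer_mod_group (m l)\<^esub> (e mod m l) =
    \<gamma> l [^]\<^bsub>integer_mod_group (m l)\<^esub> (e :: nat)"
  by (simp add: zmod_int mod_mult_left_eq)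

text \<open>Turns the definite description behind \<open>cyc_exp\<close> into a computation rule:
  exponents that are right in every coordinate may be reduced mod \<open>m l\<close>, and uniqueness
  of the normal form identifies the reduced family with \<open>ex x\<close>.\<close>

lemma ex_eqI:
  assumes "x \<in> carrier G" "\<And>l. l \<in> {1..n} \<Longrightarrow> x l = \<gamma> l [^]\<^bsub>integer_mod_group (m l)\<^esub> (i l :: nat)"
    and "l \<in> {1..n}"
  shows "ex x l = i l mod m l"
proof -
  let ?j = "\<lambda>l\<in>{1..n}. i l mod m l"
  note normal_form_unique[OF assms(1)]
  moreover have "?j \<in> (\<Pi>\<^sub>E l\<in>{1..n}. {0..<m l})"
    using pos by (auto simp: Suc_le_eq)
  moreover have "x = (\<Otimes>\<^bsub>G\<^esub>l\<in>{1..n}. g l [^]\<^bsub>G\<^esub> ?j l)"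
  proof (rule cyc_prod_eqI[OF assms(1) finprod_g_closed])
    fix l assume l: "l \<in> {1..n}"
    show "x l = (\<Otimes>\<^bsub>G\<^esub>l\<in>{1..n}. g l [^]\<^bsub>G\<^esub> ?j l) l"
      unfolding finprod_g_nth[OF l] using l pow_gen_mod[of l "i l"] assms(2)[OF l]
      by (simp del: pow_integer_mod_group)
  qed
  ultimately have "ex x = ?j" using ex_props[OF assms(1)] by blast
  then show ?thesis using assms(3) by simp
qed

lemma ex_mult:
  assumes "x \<in> carrier G" "y \<in> carrier G" "l \<in> {1..n}"
  shows "ex (x \<otimes>\<^bsub>G\<^esub> y) l = (ex x l + ex y l) mod m l"
proof (rule ex_eqI)
  fix l assume l: "l \<in> {1..n}"
  interpret L: group "integer_mod_group (m l)" by simp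
  have "(x \<otimes>\<^bsub>G\<^esub> y) l = x l \<otimes>\<^bsub>integer_mod_group (m l)\<^esub> y l"
    using l by (simp add: cyc_prod_def)
  then show "(x \<otimes>\<^bsub>G\<^esub> y) l = \<gamma> l [^]\<^bsub>integer_mod_group (m l)\<^esub> (ex x l + ex y l)"
    using L.nat_pow_mult[OF gen_closed[OF l], of "ex x l" "ex y l"]
      nth_eq_pow_ex[OF assms(1) l] nth_eq_pow_ex[OF assms(2) l] by metis
qed (use assms in auto)

lemma ex_one: "l \<in> {1..n} \<Longrightarrow> ex \<one>\<^bsub>G\<^esub> l = 0"
  using ex_eqI[of "\<one>\<^bsub>G\<^esub>" "\<lambda>_. 0" l] by (auto simp: cyc_prod_def)

text \<open>The value \<open>1 mod m i\<close> covers a trivial factor: if \<open>m i = 1\<close>,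
  the generator is the identity and its exponent is 0.\<close>

lemma ex_g:
  assumes "i \<in> {1..n}" "l \<in> {1..n}"
  shows "ex (g i) l = (if l = i then 1 mod m i else 0)"
proof -
  have "ex (g i) l = (if l = i then 1 else 0) mod m l"
  proof (rule ex_eqI[OF g_closed[OF assms(1)] _ assms(2)])
    fix l assume l: "l \<in> {1..n}"
    interpret L: group "integer_mod_group (m l)" by simp
    show "g i l = \<gamma> l [^]\<^bsub>integer_mod_group (m l)\<^esub> (if l = i then 1 else 0 :: nat)"
      using l gen_closed[OF l] L.nat_pow_eone[of "\<gamma> l"]
      by (auto simp: cyc_gen_def simp del: pow_integer_mod_group)
  qed
  then show ?thesis by auto
qed

lemma ex_g_pow:
  assumes "i \<in> {1..n}" "l \<in> {1..n}"
  shows "ex (g i [^]\<^bsub>G\<^esub> (q::nat)) l = (if l = i then q mod m i else 0)"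
proof (induction q)
  case (Suc q)
  then show ?case
    using assms ex_mult[of "g i [^]\<^bsub>G\<^esub> q" "g i" l] g_closed[OF assms(1)]
    by (auto simp: ex_g mod_simps)
qed (use assms in \<open>auto simp: ex_one\<close>)

text \<open>Exponents determine an element, and those of this power all vanish since
  \<open>m i mod m i = 0\<close>.\<close>

lemma g_pow_eq_one:
  assumes "i \<in> {1..n}"
  shows "g i [^]\<^bsub>G\<^esub> m i = \<one>\<^bsub>G\<^esub>"
proof (rule cyc_prod_eqI)
  fix l assume l: "l \<in> {1..n}"
  then have "ex (g i [^]\<^bsub>G\<^esub> m i) l = ex \<one>\<^bsub>G\<^esub> l"
    using assms by (simp add: ex_g_pow ex_one)
  then show "(g i [^]\<^bsub>G\<^esub> m i) l = \<one>\<^bsub>G\<^esub> l"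
    using nth_eq_pow_ex[OF _ l] g_closed[OF assms] by (metis nat_pow_closed one_closed)
qed (use g_closed[OF assms] in auto)

end

section \<open>The cocycle and its carry part\<close>

locale cyclic_cocycle = cyclic_product +
  fixes \<zeta> :: "nat \<Rightarrow> 'k::field"
    and a1 :: "nat \<Rightarrow> int" and a2 :: "nat \<Rightarrow> nat \<Rightarrow> int" and a3 :: "nat \<Rightarrow> nat \<Rightarrow> nat \<Rightarrow> int"
  assumes prim: "d \<ge> 1 \<Longrightarrow> primitive_root_of_unity d (\<zeta> d)"
    and a1_bounds: "1 \<le> l \<Longrightarrow> l \<le> n \<Longrightarrow> 0 \<le> a1 l \<and> a1 l < int (m l)"
    and a2_bounds: "1 \<le> s \<Longrightarrow> s < t \<Longrightarrow> t \<le> n \<Longrightarrow> 0 \<le> a2 s t \<and> a2 s t < int (gcd (m s) (m t))"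
    and a3_bounds: "1 \<le> p \<Longrightarrow> p < s \<Longrightarrow> s < t \<Longrightarrow> t \<le> n \<Longrightarrow>
      0 \<le> a3 p s t \<and> a3 p s t < int (gcd (m p) (gcd (m s) (m t)))"
begin

abbreviation "\<omega> \<equiv> cocycle \<zeta> n m \<gamma> a1 a2 a3"

text \<open>The parameters \<open>a1\<close> and \<open>a2\<close> enter the cocycle in the same
  way: a root of unity of order \<open>m t\<close>, the exponent of the first argument at
  \<open>t\<close>, the carry at \<open>s\<close>. As one triangular matrix they allow products over
  the full square of indices and a uniform treatment of \<open>i < j\<close>, \<open>i = j\<close>
  and \<open>i > j\<close>.\<close>

definition carry_coeff :: "nat \<Rightarrow> nat \<Rightarrow> int" where
  "carry_coeff s t = (if s = t then a1 t else if s < t then a2 s t else 0)"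

text \<open>For arguments in the group the quotient by \<open>m s\<close> is 0 or 1: the carry in
  coordinate \<open>s\<close> when the exponents of \<open>y\<close> and \<open>z\<close> are
  added.\<close>

definition carry_cocycle :: "(nat \<Rightarrow> int) \<Rightarrow> (nat \<Rightarrow> int) \<Rightarrow> (nat \<Rightarrow> int) \<Rightarrow> 'k" where
  "carry_cocycle x y z = (\<Prod>t\<in>{1..n}. \<Prod>s\<in>{1..n}.
     \<zeta> (m t) powi (carry_coeff s t * int (ex x t) * int ((ex y s + ex z s) div m s)))"

lemma \<zeta>_nonzero: "t \<in> {1..n} \<Longrightarrow> \<zeta> (m t) \<noteq> 0"
  using primitive_root_of_unity_nonzero[OF prim] pos by blast

lemma carry_cocycle_nonzero: "carry_cocycle x y z \<noteq> 0"
  using \<zeta>_nonzero by (simp add: carry_cocycle_def)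

lemma carry_cocycle_commute: "carry_cocycle x y z = carry_cocycle x z y"
  by (simp add: carry_cocycle_def add.commute)

text \<open>The bounds on the parameters leave only 0 when a modulus is 1. This settles the trivial
  factors, whose generators have exponent 0 instead of 1.\<close>

lemma carry_coeff_eq_0:
  assumes "s \<in> {1..n}" "t \<in> {1..n}" "m s = 1 \<or> m t = 1"
  shows "carry_coeff s t = 0"
  using assms a1_bounds[of s] a2_bounds[of s t] by (auto simp: carry_coeff_def)

lemma cocycle_eq_carry_cocycle:
  assumes "\<forall>p s t. 1 \<le> p \<and> p < s \<and> s < t \<and> t \<le> n \<longrightarrow> a3 p s t = 0"
  shows "\<omega> x y z = carry_cocycle x y z"
proof -
  let ?f = "\<lambda>s t. \<zeta> (m t) powi (carry_coeff s t * int (ex x t) * int ((ex y s + ex z s) div m s))"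
  have "(\<Prod>s\<in>{1..n}. ?f s t) =
      \<zeta> (m t) powi (a1 t * int (ex x t) * int ((ex y t + ex z t) div m t)) *
      (\<Prod>s\<in>{1..<t}. \<zeta> (m t) powi (a2 s t * int (ex x t) * int ((ex y s + ex z s) div m s)))"
    if t: "t \<in> {1..n}" for t
  proof -
    \<comment> \<open>Entries with \<open>s > t\<close> have coefficient 0. Of the rest,
      \<open>s = t\<close> yields the \<open>a1\<close> factor and \<open>s < t\<close> the
      \<open>a2\<close> factors.\<close>
    have "(\<Prod>s\<in>{1..n}. ?f s t) = (\<Prod>s\<in>{1..t}. ?f s t)"
      using t by (intro prod.mono_neutral_right) (auto simp: carry_coeff_def)
    also have "{1..t} = insert t {1..<t}" using t by auto
    also have "(\<Prod>s\<in>insert t {1..<t}. ?f s t) = ?f t t * (\<Prod>s\<in>{1..<t}. ?f s t)"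
      by (rule prod.insert) auto
    also have "(\<Prod>s\<in>{1..<t}. ?f s t) =
        (\<Prod>s\<in>{1..<t}. \<zeta> (m t) powi (a2 s t * int (ex x t) * int ((ex y s + ex z s) div m s)))"
      by (intro prod.cong) (auto simp: carry_coeff_def)
    finally show ?thesis by (simp add: carry_coeff_def)
  qed
  then show ?thesis
    using assms by (simp add: carry_cocycle_def cocycle_def Let_def prod.distrib)
qed

section \<open>Necessary conditions: vanishing of \<open>a3\<close> and powers of the values at
  generators\<close>

lemma cocycle_distinct_gens:
  assumes "i \<in> {1..n}" "j \<in> {1..n}" "k \<in> {1..n}" "j \<noteq> k" "m j > 1" "m k > 1" "m i > 1"
  shows "\<omega> (g i) (g j) (g k) =
    (if k < j \<and> j < i then \<zeta> (gcd (m k) (gcd (m j) (m i))) powi (- a3 k j i) else 1)"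
proof -
  \<comment> \<open>Since \<open>j\<close> and \<open>k\<close> differ, no coordinate of the sum
    exceeds 1, and both moduli concerned are greater than 1. Hence the \<open>a1\<close> and
    \<open>a2\<close> factors are trivial.\<close>
  have no_carry: "(ex (g j) l + ex (g k) l) div m l = 0" if "l \<in> {1..n}" for l
    using assms that by (auto simp: ex_g)
  have 1: "(\<Prod>l\<in>{1..n}. \<zeta> (m l) powi
      (a1 l * int (ex (g i) l) * int ((ex (g j) l + ex (g k) l) div m l))) = 1"
    by (rule prod.neutral) (use no_carry in auto)
  have 2: "(\<Prod>t\<in>{1..n}. \<Prod>s\<in>{1..<t}. \<zeta> (m t) powi
      (a2 s t * int (ex (g i) t) * int ((ex (g j) s + ex (g k) s) div m s))) = 1"
    by (intro prod.neutral ballI) (use no_carry in auto)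
  let ?h = "\<lambda>t s r. \<zeta> (gcd (m r) (gcd (m s) (m t))) powi
      (- a3 r s t * int (ex (g k) r) * int (ex (g j) s) * int (ex (g i) t))"
  have 3: "?h t s r = (if t = i then if s = j then if r = k
      then \<zeta> (gcd (m k) (gcd (m j) (m i))) powi (- a3 k j i) else 1 else 1 else 1)"
    if "t \<in> {1..n}" "s \<in> {1..<t}" "r \<in> {1..<s}" for t s r
    using that assms by (auto simp: ex_g)
  have "(\<Prod>t\<in>{1..n}. \<Prod>s\<in>{1..<t}. \<Prod>r\<in>{1..<s}. ?h t s r) =
    (\<Prod>t\<in>{1..n}. \<Prod>s\<in>{1..<t}. \<Prod>r\<in>{1..<s}. if t = i then if s = j then if r = k
      then \<zeta> (gcd (m k) (gcd (m j) (m i))) powi (- a3 k j i) else 1 else 1 else 1)"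
    by (intro prod.cong refl 3)
  also have "\<dots> = (\<Prod>t\<in>{1..n}. if t = i then \<Prod>s\<in>{1..<t}. if s = j then \<Prod>r\<in>{1..<s}. if r = k
      then \<zeta> (gcd (m k) (gcd (m j) (m i))) powi (- a3 k j i) else 1 else 1 else 1)"
    by (simp only: prod_if_const)
  \<comment> \<open>The ranges of the inner products become the condition \<open>k < j < i\<close>:
    the first argument supplies the largest index, the last argument the smallest.\<close>
  also have "\<dots> = (if k < j \<and> j < i
      then \<zeta> (gcd (m k) (gcd (m j) (m i))) powi (- a3 k j i) else 1)"
    using assms by (simp add: prod.delta)
  finally show ?thesis
    unfolding cocycle_def Let_def 1 2 by simp
qed

lemma quasi_bicharacter_imp_a3_eq_0:
  assumes R: "quasi_bicharacter G \<omega> R"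
  shows "\<forall>p s t. 1 \<le> p \<and> p < s \<and> s < t \<and> t \<le> n \<longrightarrow> a3 p s t = 0"
proof (intro allI impI, elim conjE)
  fix p s t assume pst: "1 \<le> p" "p < s" "s < t" "t \<le> n"
  define d where "d = gcd (m p) (gcd (m s) (m t))"
  note bounds = a3_bounds[OF pst, folded d_def]
  have ind: "p \<in> {1..n}" "s \<in> {1..n}" "t \<in> {1..n}" using pst by auto
  show "a3 p s t = 0"
  \<comment> \<open>If one of the three factors is trivial, the gcd is 1 and the bound alone forces
    0.\<close>
  proof (cases "m p > 1 \<and> m s > 1 \<and> m t > 1")
    case False
    then have "m p = 1 \<or> m s = 1 \<or> m t = 1" using pos ind by force
    then have "d = 1" by (auto simp: d_def)
    with bounds show ?thesis by simp
  next
    case True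
    \<comment> \<open>As \<open>p < s < t\<close>, among the six cocycle values in the two
      expansions only \<open>\<omega> ?z ?x ?y\<close> has its indices in decreasing order, so it
      alone can differ from 1.\<close>
    let ?x = "g s" and ?y = "g p" and ?z = "g t"
    have cl: "?x \<in> carrier G" "?y \<in> carrier G" "?z \<in> carrier G" using ind g_closed by auto
    have nz: "R ?x ?z \<noteq> 0" "R ?y ?z \<noteq> 0"
      using R cl by (auto simp: quasi_bicharacter_def)
    have "R (?x \<otimes>\<^bsub>G\<^esub> ?y) ?z = R (?y \<otimes>\<^bsub>G\<^esub> ?x) ?z" using cl by (simp add: m_comm)
    moreover have "R (?x \<otimes>\<^bsub>G\<^esub> ?y) ?z =
        \<omega> ?z ?x ?y * R ?x ?z * inverse (\<omega> ?x ?z ?y) * R ?y ?z * \<omega> ?x ?y ?z"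
      "R (?y \<otimes>\<^bsub>G\<^esub> ?x) ?z =
        \<omega> ?z ?y ?x * R ?y ?z * inverse (\<omega> ?y ?z ?x) * R ?x ?z * \<omega> ?y ?x ?z"
      using R cl unfolding quasi_bicharacter_def by blast+
    ultimately have "\<zeta> d powi (- a3 p s t) = 1"
      using nz True pst ind by (simp add: cocycle_distinct_gens d_def)
    then have "\<zeta> d powi a3 p s t = 1" by (simp add: power_int_minus)
    moreover have "d \<ge> 1" using True by (auto simp: d_def Suc_le_eq)
    ultimately show ?thesis
      using primitive_root_of_unity_powi_eq_1D[OF prim] bounds by blast
  qed
qed

text \<open>In its first argument \<open>S\<close> is a character up to carries. Building up powers
  of \<open>g i\<close> one step at a time picks up a fixed root of unity at every wraparound; at
  the power \<open>m i\<close> there has been one wraparound and the argument is the identity.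
  Keeping \<open>S\<close> abstract lets both hexagons use this.\<close>

lemma twisted_character_gen_power:
  assumes S: "\<And>x y z. x \<in> carrier G \<Longrightarrow> y \<in> carrier G \<Longrightarrow> z \<in> carrier G \<Longrightarrow>
      S (x \<otimes>\<^bsub>G\<^esub> y) z = S x z * S y z * carry_cocycle z x y"
    and nz: "\<And>x y. x \<in> carrier G \<Longrightarrow> y \<in> carrier G \<Longrightarrow> S x y \<noteq> 0"
    and i: "i \<in> {1..n}" and j: "j \<in> {1..n}"
  shows "S (g i) (g j) ^ m i = \<zeta> (m j) powi (- carry_coeff i j)"
proof -
  note cl = g_closed[OF i] g_closed[OF j]
  have one: "S \<one>\<^bsub>G\<^esub> (g j) = 1"
  proof -
    have "carry_cocycle (g j) \<one>\<^bsub>G\<^esub> \<one>\<^bsub>G\<^esub> = 1"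
      unfolding carry_cocycle_def by (intro prod.neutral ballI) (simp add: ex_one)
    then show ?thesis
      using S[of "\<one>\<^bsub>G\<^esub>" "\<one>\<^bsub>G\<^esub>" "g j"] nz[of "\<one>\<^bsub>G\<^esub>" "g j"] cl by simp
  qed
  have step: "carry_cocycle (g j) (g i [^]\<^bsub>G\<^esub> q) (g i) =
      \<zeta> (m j) powi (carry_coeff i j * int ((q mod m i + 1 mod m i) div m i))" for q
  proof -
    have "carry_cocycle (g j) (g i [^]\<^bsub>G\<^esub> q) (g i) = (\<Prod>t\<in>{1..n}. \<Prod>s\<in>{1..n}.
      if t = j then if s = i then
        \<zeta> (m j) powi (carry_coeff i j * int ((q mod m i + 1 mod m i) div m i)) else 1 else 1)"
      unfolding carry_cocycle_def
    proof (intro prod.cong refl)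
      fix t s assume ts: "t \<in> {1..n}" "s \<in> {1..n}"
      \<comment> \<open>The exponent of \<open>g j\<close> is 0 if \<open>m j = 1\<close>, but then
        the coefficient is 0 as well.\<close>
      have "carry_coeff i j * int (1 mod m j) = carry_coeff i j"
        using carry_coeff_eq_0[OF i j] pos[OF j] by (cases "m j = 1") auto
      then show "\<zeta> (m t) powi (carry_coeff s t * int (ex (g j) t) *
          int ((ex (g i [^]\<^bsub>G\<^esub> q) s + ex (g i) s) div m s)) =
        (if t = j then if s = i then
        \<zeta> (m j) powi (carry_coeff i j * int ((q mod m i + 1 mod m i) div m i)) else 1 else 1)"
        using ts i j by (auto simp: ex_g ex_g_pow)
    qed
    also have "\<dots> = (\<Prod>t\<in>{1..n}. if t = j then \<Prod>s\<in>{1..n}. if s = i then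
        \<zeta> (m j) powi (carry_coeff i j * int ((q mod m i + 1 mod m i) div m i)) else 1 else 1)"
      by (simp only: prod_if_const)
    finally show ?thesis using i j by (simp add: prod.delta)
  qed
  have "S (g i [^]\<^bsub>G\<^esub> q) (g j) =
      S (g i) (g j) ^ q * \<zeta> (m j) powi (carry_coeff i j * int (q div m i))" for q
  proof (induction q)
    case (Suc q)
    \<comment> \<open>For \<open>m i > 1\<close> the quotient \<open>q div m i\<close> counts the
      carries so far. For \<open>m i = 1\<close> it grows although no carry ever occurs; the
      identity survives because the coefficient vanishes.\<close>
    have "carry_coeff i j * int (q div m i) +
        carry_coeff i j * int ((q mod m i + 1 mod m i) div m i) = carry_coeff i j * int (Suc q div m i)"
    proof (cases "m i = 1")
      case False
      have "Suc q div m i = q div m i + 1 div m i + (q mod m i + 1 mod m i) div m i"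
        using div_add1_eq[of q 1 "m i"] by simp
      moreover have "1 div m i = 0" using False pos[OF i] by simp
      ultimately show ?thesis by (simp add: algebra_simps)
    qed (simp add: carry_coeff_eq_0[OF i j])
    then have "\<zeta> (m j) powi (carry_coeff i j * int (q div m i)) *
        \<zeta> (m j) powi (carry_coeff i j * int ((q mod m i + 1 mod m i) div m i)) =
        \<zeta> (m j) powi (carry_coeff i j * int (Suc q div m i))"
      using \<zeta>_nonzero[OF j] by (metis power_int_add)
    then show ?case
      using S[of "g i [^]\<^bsub>G\<^esub> q" "g i" "g j"] cl by (simp add: step Suc.IH mult_ac)
  qed (use one in auto)
  from this[of "m i"] have "S (g i) (g j) ^ m i * \<zeta> (m j) powi carry_coeff i j = 1"
    using g_pow_eq_one[OF i] one pos[OF i] by simp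
  then show ?thesis
    using \<zeta>_nonzero[OF j] by (simp add: power_int_minus field_simps)
qed

text \<open>Symmetry in the last two arguments cancels \<open>\<omega> x z y\<close> against
  \<open>\<omega> x y z\<close> in the first hexagon and \<open>\<omega> y z x\<close> against
  \<open>\<omega> y x z\<close> in the second.\<close>

lemma quasi_bicharacter_carry_iff:
  assumes a3: "\<forall>p s t. 1 \<le> p \<and> p < s \<and> s < t \<and> t \<le> n \<longrightarrow> a3 p s t = 0"
  shows "quasi_bicharacter G \<omega> R \<longleftrightarrow>
     (\<forall>x\<in>carrier G. \<forall>y\<in>carrier G. R x y \<noteq> 0) \<and>
     (\<forall>x\<in>carrier G. \<forall>y\<in>carrier G. \<forall>z\<in>carrier G.
        R (x \<otimes>\<^bsub>G\<^esub> y) z = R x z * R y z * carry_cocycle z x y \<and>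
        R x (y \<otimes>\<^bsub>G\<^esub> z) = R x y * R x z * inverse (carry_cocycle x y z))"
proof -
  have "\<omega> z x y * R x z * inverse (\<omega> x z y) * R y z * \<omega> x y z =
      R x z * R y z * carry_cocycle z x y" for x y z
    using cocycle_eq_carry_cocycle[OF a3] carry_cocycle_nonzero[of x z y]
      carry_cocycle_commute[of x y z] by simp
  moreover have "inverse (\<omega> y z x) * R x z * \<omega> y x z * R x y * inverse (\<omega> x y z) =
      R x y * R x z * inverse (carry_cocycle x y z)" for x y z
    using cocycle_eq_carry_cocycle[OF a3] carry_cocycle_nonzero[of y x z]
      carry_cocycle_commute[of y z x] by simp
  ultimately show ?thesis by (simp only: quasi_bicharacter_def)
qed

lemma quasi_bicharacter_gen_power:
  assumes R: "quasi_bicharacter G \<omega> R" and ij: "i \<in> {1..n}" "j \<in> {1..n}"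
  shows "R (g i) (g j) ^ m i = \<zeta> (m j) powi (- carry_coeff i j)"
    and "R (g i) (g j) ^ m j = \<zeta> (m i) powi carry_coeff j i"
proof -
  note R' = R[unfolded quasi_bicharacter_carry_iff[OF quasi_bicharacter_imp_a3_eq_0[OF R]]]
  show "R (g i) (g j) ^ m i = \<zeta> (m j) powi (- carry_coeff i j)"
    using R' ij by (intro twisted_character_gen_power) auto
  \<comment> \<open>Inverting and swapping the arguments turns the second hexagon into the first.\<close>
  have "inverse (R (g i) (g j)) ^ m j = \<zeta> (m i) powi (- carry_coeff j i)"
    using R' ij by (intro twisted_character_gen_power[where S = "\<lambda>x z. inverse (R z x)"]) auto
  then show "R (g i) (g j) ^ m j = \<zeta> (m i) powi carry_coeff j i"
    by (simp add: power_inverse power_int_minus)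
qed

section \<open>Construction of a quasi-bicharacter from its values at generators\<close>

lemma quasi_bicharacter_exists:
  fixes r :: "nat \<Rightarrow> nat \<Rightarrow> 'k"
  assumes a3: "\<forall>p s t. 1 \<le> p \<and> p < s \<and> s < t \<and> t \<le> n \<longrightarrow> a3 p s t = 0"
    and nz: "\<And>i j. i \<in> {1..n} \<Longrightarrow> j \<in> {1..n} \<Longrightarrow> r i j \<noteq> 0"
    and left: "\<And>i j. i \<in> {1..n} \<Longrightarrow> j \<in> {1..n} \<Longrightarrow> r i j ^ m i = \<zeta> (m j) powi (- carry_coeff i j)"
    and right: "\<And>i j. i \<in> {1..n} \<Longrightarrow> j \<in> {1..n} \<Longrightarrow> r i j ^ m j = \<zeta> (m i) powi carry_coeff j i"
  shows "\<exists>R. quasi_bicharacter G \<omega> R \<and> (\<forall>i\<in>{1..n}. \<forall>j\<in>{1..n}. R (g i) (g j) = r i j)"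
proof (intro exI conjI ballI)
  define R where "R x y = (\<Prod>i\<in>{1..n}. \<Prod>j\<in>{1..n}. r i j ^ (ex x i * ex y j))" for x y
  \<comment> \<open>The formula for \<open>R\<close> would be bimultiplicative if exponents were not
    reduced. Reduction from \<open>u\<close> to \<open>u mod d\<close> drops \<open>u div d\<close>
    blocks of \<open>b ^ d\<close>, each a known power of \<open>c\<close>. Below, \<open>u\<close>
    is a sum of two exponents, so the number of blocks is the carry, and \<open>e\<close> is the
    exponent of the other argument.\<close>
  have reduce: "b ^ ((u mod d) * e) = b ^ (u * e) * c powi (k * int e * int (u div d))"
    if "b ^ d = c powi (- k)" "c \<noteq> 0" for b c :: 'k and u d e :: nat and k
  proof -
    have "b ^ (u * e) = b ^ ((u mod d) * e + d * ((u div d) * e))"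
      by (metis add_mult_distrib mod_mult_div_eq mult.assoc)
    also have "\<dots> = b ^ ((u mod d) * e) * (c powi (- k)) ^ ((u div d) * e)"
      by (simp add: power_add power_mult that(1))
    also have "(c powi (- k)) ^ ((u div d) * e) = c powi (- (k * int e * int (u div d)))"
      by (simp add: mult_ac flip: power_int_of_nat power_int_mult)
    finally show ?thesis using that(2) by (simp add: power_int_minus)
  qed
  show "quasi_bicharacter G \<omega> R"
    unfolding quasi_bicharacter_carry_iff[OF a3]
  proof (intro conjI ballI)
    show "R x y \<noteq> 0" for x y using nz by (simp add: R_def)
  next
    fix x y z assume cl: "x \<in> carrier G" "y \<in> carrier G" "z \<in> carrier G"
    have "R (x \<otimes>\<^bsub>G\<^esub> y) z = (\<Prod>i\<in>{1..n}. \<Prod>j\<in>{1..n}. r i j ^ (ex x i * ex z j) *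
        r i j ^ (ex y i * ex z j) *
        \<zeta> (m j) powi (carry_coeff i j * int (ex z j) * int ((ex x i + ex y i) div m i)))"
      unfolding R_def using cl reduce[OF left \<zeta>_nonzero]
      by (intro prod.cong refl) (simp add: ex_mult add_mult_distrib power_add)
    also have "\<dots> = R x z * R y z * (\<Prod>i\<in>{1..n}. \<Prod>j\<in>{1..n}.
        \<zeta> (m j) powi (carry_coeff i j * int (ex z j) * int ((ex x i + ex y i) div m i)))"
      by (simp add: R_def prod.distrib)
    also have "(\<Prod>i\<in>{1..n}. \<Prod>j\<in>{1..n}.
        \<zeta> (m j) powi (carry_coeff i j * int (ex z j) * int ((ex x i + ex y i) div m i))) =
        carry_cocycle z x y"
      unfolding carry_cocycle_def by (rule prod.swap)
    finally show "R (x \<otimes>\<^bsub>G\<^esub> y) z = R x z * R y z * carry_cocycle z x y" .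
    \<comment> \<open>The double negation matches the premise of \<open>reduce\<close> with
      \<open>k = - carry_coeff j i\<close>; this sign is why the second hexagon gets the inverse of
      the carry factor.\<close>
    have right': "r i j ^ m j = \<zeta> (m i) powi (- (- carry_coeff j i))"
      if "i \<in> {1..n}" "j \<in> {1..n}" for i j using right that by simp
    have "R x (y \<otimes>\<^bsub>G\<^esub> z) = (\<Prod>i\<in>{1..n}. \<Prod>j\<in>{1..n}. r i j ^ (ex x i * ex y j) *
        r i j ^ (ex x i * ex z j) *
        inverse (\<zeta> (m i) powi (carry_coeff j i * int (ex x i) * int ((ex y j + ex z j) div m j))))"
      unfolding R_def
    proof (intro prod.cong refl)
      fix i j assume ij: "i \<in> {1..n}" "j \<in> {1..n}"
      show "r i j ^ (ex x i * ex (y \<otimes>\<^bsub>G\<^esub> z) j) = r i j ^ (ex x i * ex y j) *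
        r i j ^ (ex x i * ex z j) *
        inverse (\<zeta> (m i) powi (carry_coeff j i * int (ex x i) * int ((ex y j + ex z j) div m j)))"
        using ij cl reduce[OF right'[OF ij] \<zeta>_nonzero[OF ij(1)], of "ex y j + ex z j" "ex x i"]
        by (simp add: ex_mult add_mult_distrib power_add power_int_minus mult.commute[of "ex x i"])
    qed
    then show "R x (y \<otimes>\<^bsub>G\<^esub> z) = R x y * R x z * inverse (carry_cocycle x y z)"
      by (simp add: R_def carry_cocycle_def prod.distrib prod_inversef[unfolded comp_def])
  qed
  fix i j assume ij: "i \<in> {1..n}" "j \<in> {1..n}"
  have "R (g i) (g j) = (\<Prod>k\<in>{1..n}. \<Prod>l\<in>{1..n}. if k = i then if l = j then
      r i j ^ ((1 mod m i) * (1 mod m j)) else 1 else 1)"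
    unfolding R_def by (intro prod.cong refl) (use ij in \<open>auto simp: ex_g\<close>)
  also have "\<dots> = (\<Prod>k\<in>{1..n}. if k = i then \<Prod>l\<in>{1..n}. if l = j then
      r i j ^ ((1 mod m i) * (1 mod m j)) else 1 else 1)"
    by (simp only: prod_if_const)
  also have "\<dots> = r i j ^ ((1 mod m i) * (1 mod m j))"
    using ij by (simp add: prod.delta)
  also have "\<dots> = r i j"
  \<comment> \<open>If a factor is trivial, the power is the zeroth one, so \<open>r i j\<close>
    itself has to be 1. One of the power equations then has exponent 1 on the left and coefficient 0
    on the right, which says exactly this.\<close>
  proof (cases "m i = 1 \<or> m j = 1")
    case True
    then have "r i j = 1"
      using left[OF ij] right[OF ij] carry_coeff_eq_0[OF ij] carry_coeff_eq_0[OF ij(2,1)] by auto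
    then show ?thesis by simp
  next
    case False
    then have "m i > 1" "m j > 1" using pos ij by force+
    then show ?thesis by simp
  qed
  finally show "R (g i) (g j) = r i j" .
qed

end

section \<open>Matching the uniform equations with the stated ones\<close>

theorem proposition4p1:
  fixes \<zeta> :: "nat \<Rightarrow> 'k::{alg_closed_field, field_char_0}"
    and n :: nat
    and m :: "nat \<Rightarrow> nat"
    and \<gamma> :: "nat \<Rightarrow> int"
    and a1 :: "nat \<Rightarrow> int"
    and a2 :: "nat \<Rightarrow> nat \<Rightarrow> int"
    and a3 :: "nat \<Rightarrow> nat \<Rightarrow> nat \<Rightarrow> int"
    and r :: "nat \<Rightarrow> nat \<Rightarrow> 'k"
  assumes "\<And>d. d \<ge> 1 \<Longrightarrow> primitive_root_of_unity d (\<zeta> d)"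
    and "n \<ge> 1"
    and "\<And>l. l \<in> {1..n} \<Longrightarrow> m l \<ge> 1"
    and "\<And>l. l \<in> {1..n} \<Longrightarrow> \<gamma> l \<in> carrier (integer_mod_group (m l))"
    and "\<And>l. l \<in> {1..n} \<Longrightarrow>
           generate (integer_mod_group (m l)) {\<gamma> l} = carrier (integer_mod_group (m l))"
    and "\<And>l. 1 \<le> l \<Longrightarrow> l \<le> n \<Longrightarrow> 0 \<le> a1 l \<and> a1 l < int (m l)"
    and "\<And>s t. 1 \<le> s \<Longrightarrow> s < t \<Longrightarrow> t \<le> n \<Longrightarrow> 0 \<le> a2 s t \<and> a2 s t < int (gcd (m s) (m t))"
    and "\<And>p s t. 1 \<le> p \<Longrightarrow> p < s \<Longrightarrow> s < t \<Longrightarrow> t \<le> n \<Longrightarrow>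
           0 \<le> a3 p s t \<and> a3 p s t < int (gcd (m p) (gcd (m s) (m t)))"
    and "\<And>i j. i \<in> {1..n} \<Longrightarrow> j \<in> {1..n} \<Longrightarrow> r i j \<noteq> 0"
  shows "(\<exists>R. quasi_bicharacter (cyc_prod n m) (cocycle \<zeta> n m \<gamma> a1 a2 a3) R \<and>
            (\<forall>i\<in>{1..n}. \<forall>j\<in>{1..n}. R (cyc_gen n m \<gamma> i) (cyc_gen n m \<gamma> j) = r i j))
     \<longleftrightarrow>
       (\<forall>i. 1 \<le> i \<and> i \<le> n \<longrightarrow>
          r i i ^ m i = \<zeta> (m i) powi a1 i \<and> \<zeta> (m i) powi a1 i = \<zeta> (m i) powi (- a1 i)) \<and>
       (\<forall>i j. 1 \<le> i \<and> i < j \<and> j \<le> n \<longrightarrow>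
          r i j ^ m i = \<zeta> (m j) powi (- a2 i j) \<and> r i j ^ m j = 1) \<and>
       (\<forall>i j. n \<ge> i \<and> i > j \<and> j \<ge> 1 \<longrightarrow>
          r i j ^ m j = \<zeta> (m i) powi (a2 j i) \<and> r i j ^ m i = 1) \<and>
       (\<forall>p s t. 1 \<le> p \<and> p < s \<and> s < t \<and> t \<le> n \<longrightarrow> a3 p s t = 0)" (is "?lhs \<longleftrightarrow> ?rhs")
proof -
  interpret cyclic_cocycle n m \<gamma> \<zeta> a1 a2 a3
    using assms(1,3-8) by unfold_locales
  \<comment> \<open>The three families of equations are the cases \<open>i = j\<close>,
    \<open>i < j\<close> and \<open>i > j\<close> of one pair of equations. On the diagonal both
    equations have the same left side, whence the two expressions for \<open>r i i ^ m i\<close>;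
    the zeros below the diagonal of \<open>carry_coeff\<close> give the right sides equal to
    1.\<close>
  have coeff_eqs: "?rhs \<longleftrightarrow>
      (\<forall>i\<in>{1..n}. \<forall>j\<in>{1..n}. r i j ^ m i = \<zeta> (m j) powi (- carry_coeff i j) \<and>
         r i j ^ m j = \<zeta> (m i) powi carry_coeff j i) \<and>
      (\<forall>p s t. 1 \<le> p \<and> p < s \<and> s < t \<and> t \<le> n \<longrightarrow> a3 p s t = 0)" (is "_ \<longleftrightarrow> ?coeff \<and> ?a3")
  proof (intro iffI conjI)
    assume rhs: ?rhs
    then show ?a3 by blast
    show ?coeff
    proof (intro ballI)
      fix i j assume "i \<in> {1..n}" "j \<in> {1..n}"
      then show "r i j ^ m i = \<zeta> (m j) powi (- carry_coeff i j) \<and>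
          r i j ^ m j = \<zeta> (m i) powi carry_coeff j i"
        using rhs by (cases i j rule: linorder_cases) (auto simp: carry_coeff_def)
    qed
  next
    assume *: "?coeff \<and> ?a3"
    then have c: "r i j ^ m i = \<zeta> (m j) powi (- carry_coeff i j)"
        "r i j ^ m j = \<zeta> (m i) powi carry_coeff j i"
      if "1 \<le> i" "i \<le> n" "1 \<le> j" "j \<le> n" for i j
      using that by auto
    show "\<forall>i. 1 \<le> i \<and> i \<le> n \<longrightarrow>
        r i i ^ m i = \<zeta> (m i) powi a1 i \<and> \<zeta> (m i) powi a1 i = \<zeta> (m i) powi (- a1 i)"
      using c by (metis carry_coeff_def)
    show "\<forall>i j. 1 \<le> i \<and> i < j \<and> j \<le> n \<longrightarrow>
        r i j ^ m i = \<zeta> (m j) powi (- a2 i j) \<and> r i j ^ m j = 1"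
      using c by (auto simp: carry_coeff_def)
    show "\<forall>i j. n \<ge> i \<and> i > j \<and> j \<ge> 1 \<longrightarrow>
        r i j ^ m j = \<zeta> (m i) powi (a2 j i) \<and> r i j ^ m i = 1"
      using c by (auto simp: carry_coeff_def)
    show ?a3 using * by blast
  qed
  show ?thesis
    unfolding coeff_eqs
  proof (intro iffI conjI)
    assume ?lhs
    then obtain R where R: "quasi_bicharacter (cyc_prod n m) (cocycle \<zeta> n m \<gamma> a1 a2 a3) R"
      and r: "\<And>i j. i \<in> {1..n} \<Longrightarrow> j \<in> {1..n} \<Longrightarrow> R (cyc_gen n m \<gamma> i) (cyc_gen n m \<gamma> j) = r i j"
      by blast
    show "\<forall>i\<in>{1..n}. \<forall>j\<in>{1..n}. r i j ^ m i = \<zeta> (m j) powi (- carry_coeff i j) \<and>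
         r i j ^ m j = \<zeta> (m i) powi carry_coeff j i"
      using quasi_bicharacter_gen_power[OF R] r by metis
    show "\<forall>p s t. 1 \<le> p \<and> p < s \<and> s < t \<and> t \<le> n \<longrightarrow> a3 p s t = 0"
      by (rule quasi_bicharacter_imp_a3_eq_0[OF R])
  next
    assume "(\<forall>i\<in>{1..n}. \<forall>j\<in>{1..n}. r i j ^ m i = \<zeta> (m j) powi (- carry_coeff i j) \<and>
         r i j ^ m j = \<zeta> (m i) powi carry_coeff j i) \<and>
      (\<forall>p s t. 1 \<le> p \<and> p < s \<and> s < t \<and> t \<le> n \<longrightarrow> a3 p s t = 0)"
    then show ?lhs
      using assms(9) by (intro quasi_bicharacter_exists) auto
  qed
qed

end
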